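(* Let $n\ge1$, let $\mathcal{A}$ be an integral domain containing $\mathbb{C}$ (an integral domain over $\mathbb{C}$), and let $z=(z_1,\dots,z_n)$. Let $\lambda=(\lambda_1,\dots,\lambda_n)\in\mathbb{R}^n$ with $\lambda_i>-1$ for all $1\le i\le n$. Set $\Phi_{\lambda_i}:=\partial_i+\lambda_iz_i^{-1}$ $(1\le i\le n)$ and $$\mathrm{Im}'\Phi_\lambda:=\mathcal{A}[z]\cap\sum_{i=1}^n\Phi_{\lambda_i}(\mathcal{A}[z]).$$ Then $\mathrm{Im}'\Phi_\lambda=\mathcal{A}[z]$, and hence $\mathrm{Im}'\Phi_\lambda$ is a Mathieu subspace of $\mathcal{A}[z]$.
   Context: $\partial_i=\partial/\partial z_i$; the operators $\Phi_{\lambda_i}$ act on the Laurent polynomial algebra $\mathcal{A}[z^{-1},z]$, in which the intersection is taken. Mathieu subspace: for a commutative ring $R$ and a commutative $R$-algebra $\mathcal{C}$, an $R$-subspace $\mathcal{M}\subset\mathcal{C}$ is a Mathieu subspace of $\mathcal{C}$ if for any $a,b\in\mathcal{C}$ with $a^m\in\mathcal{M}$ for all $m\ge1$, there exists $N\ge1$ (depending on $a,b$) such that $a^mb\in\mathcal{M}$ for all $m\ge N$. *)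

theory Defs
  imports "HOL-Library.Poly_Mapping" "HOL-Analysis.Finite_Cartesian_Product"
begin

section \<open>Mathieu subspaces of commutative algebras\<close>

text \<open>A type class ring \<open>'c\<close> with a scalar action of \<open>'r\<close>; the algebra in which Mathieu subspaces are
  considered is a unital subalgebra of it, given by its carrier.\<close>

locale commutative_algebra = module scale
  for scale :: "'r::comm_ring_1 \<Rightarrow> 'c::comm_ring_1 \<Rightarrow> 'c" +
  assumes scale_mult_left: "scale r (x * y) = scale r x * y"
begin

definition subalgebra :: "'c set \<Rightarrow> bool" where
  "subalgebra C \<longleftrightarrow> subspace C \<and> 1 \<in> C \<and> (\<forall>x\<in>C. \<forall>y\<in>C. x * y \<in> C)"

end

definition mathieu_subspace ::
  "('r::comm_ring_1 \<Rightarrow> 'c::comm_ring_1 \<Rightarrow> 'c) \<Rightarrow> 'c set \<Rightarrow> 'c set \<Rightarrow> bool" where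
  "mathieu_subspace act C M \<longleftrightarrow>
     commutative_algebra act \<and> commutative_algebra.subalgebra act C \<and>
     M \<subseteq> C \<and> module.subspace act M \<and>
     (\<forall>a\<in>C. \<forall>b\<in>C. (\<forall>m\<ge>1. a ^ m \<in> M) \<longrightarrow> (\<exists>N\<ge>1. \<forall>m\<ge>N. a ^ m * b \<in> M))"


section \<open>Laurent polynomials\<close>

text \<open>\<open>A[z\<inverse>, z]\<close> in the variables \<open>z\<^sub>i\<close>, \<open>i :: 'n\<close>, is the group algebra of \<open>\<int>\<^sup>n\<close>: the finitely supported
  maps from exponent vectors to coefficients, with convolution as multiplication.\<close>

type_synonym ('a, 'n) laurent = "(int ^ 'n) \<Rightarrow>\<^sub>0 'a"

definition lconst :: "'a::comm_ring_1 \<Rightarrow> ('a, 'n::finite) laurent" where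
  "lconst c = Poly_Mapping.single 0 c"

definition lscale :: "'a::comm_ring_1 \<Rightarrow> ('a, 'n::finite) laurent \<Rightarrow> ('a, 'n) laurent" where
  "lscale c f = lconst c * f"

definition lvar_inverse :: "'n::finite \<Rightarrow> ('a::comm_ring_1, 'n) laurent" where
  "lvar_inverse i = Poly_Mapping.single (axis i (- 1)) 1"

text \<open>The \<open>A\<close>-linear map with \<open>z\<^sup>\<alpha> \<mapsto> \<alpha>\<^sub>i z\<^bsup>\<alpha> - e\<^sub>i\<^esup>\<close>.\<close>

definition lderiv :: "'n::finite \<Rightarrow> ('a::comm_ring_1, 'n) laurent \<Rightarrow> ('a, 'n) laurent" where
  "lderiv i f = (\<Sum>\<alpha>\<in>Poly_Mapping.keys f.
     Poly_Mapping.single (\<alpha> - axis i 1) (of_int (\<alpha> $ i) * Poly_Mapping.lookup f \<alpha>))"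

text \<open>\<open>A[z]\<close> as a subalgebra of \<open>A[z\<inverse>, z]\<close>.\<close>

definition polynomials :: "('a::comm_ring_1, 'n::finite) laurent set" where
  "polynomials = {f. \<forall>\<alpha>\<in>Poly_Mapping.keys f. \<forall>i. 0 \<le> \<alpha> $ i}"


section \<open>The operators and their image\<close>

text \<open>The inclusion of the complex numbers in the coefficient domain is a parameter \<open>\<iota>\<close>. Injectivity need not be
  required, since a unital homomorphism from a field to a nonzero ring is injective.\<close>

locale complex_embedding =
  fixes \<iota> :: "complex \<Rightarrow> 'a::idom"
  assumes embed_one: "\<iota> 1 = 1"
    and embed_add: "\<iota> (x + y) = \<iota> x + \<iota> y"
    and embed_mult: "\<iota> (x * y) = \<iota> x * \<iota> y"

definition Phi :: "(complex \<Rightarrow> 'a::idom) \<Rightarrow> (real ^ 'n) \<Rightarrow> 'n::finite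
    \<Rightarrow> ('a, 'n) laurent \<Rightarrow> ('a, 'n) laurent" where
  "Phi \<iota> lam i f = lderiv i f + lscale (\<iota> (complex_of_real (lam $ i))) (lvar_inverse i * f)"

definition Im' :: "(complex \<Rightarrow> 'a::idom) \<Rightarrow> (real ^ 'n::finite) \<Rightarrow> ('a, 'n) laurent set" where
  "Im' \<iota> lam = polynomials \<inter> {(\<Sum>i\<in>UNIV. Phi \<iota> lam i (g i)) | g. \<forall>i. g i \<in> polynomials}"

end

theory Submission
  imports Defs
begin

text \<open>A single operator already maps \<open>A[z]\<close> onto a set containing \<open>A[z]\<close>: since
  \<open>\<Phi>\<^sub>i z\<^bsup>\<alpha> + e\<^sub>i\<^esup> = (\<alpha>\<^sub>i + 1 + \<lambda>\<^sub>i) z\<^sup>\<alpha>\<close> and the factor is a positive real number for \<open>\<alpha>\<^sub>i \<ge> 0\<close>,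
  hence invertible in \<open>A\<close>, every monomial of \<open>A[z]\<close> has a preimage.\<close>

context complex_embedding
begin

lemma embed_zero: "\<iota> 0 = 0"
  by (metis add.right_neutral add_left_imp_eq embed_add)

lemma embed_minus: "\<iota> (- x) = - \<iota> x"
  using embed_add[of "- x" x] by (simp add: embed_zero eq_neg_iff_add_eq_0)

lemma embed_of_nat: "\<iota> (of_nat n) = of_nat n"
  by (induction n) (simp_all add: embed_zero embed_one embed_add)

text \<open>Differentiation produces integer factors in the coefficient ring. Since \<iota> fixes
  integers, such a factor and the image of a complex number combine into the image of one complex
  number.\<close>

lemma embed_of_int: "\<iota> (of_int k) = of_int k"
  by (cases k rule: int_cases2) (simp_all add: embed_of_nat embed_minus)

end

text \<open>Exponents form a group, so only the exponent \<open>b - a\<close> of \<open>f\<close>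
  contributes to the coefficient at \<open>b\<close> in the convolution.\<close>

lemma lookup_single_times:
  fixes f :: "'k::ab_group_add \<Rightarrow>\<^sub>0 'a::comm_ring_1"
  shows "Poly_Mapping.lookup (Poly_Mapping.single a c * f) b = c * Poly_Mapping.lookup f (b - a)"
proof -
  have "(\<Sum>q. Poly_Mapping.lookup f q when b = a + q)
      = (\<Sum>q. Poly_Mapping.lookup f q when q = b - a)"
    by (intro Sum_any.cong) (auto simp: when_def)
  then show ?thesis
    by (simp add: lookup_mult lookup_single when_mult)
qed

lemma lookup_lderiv:
  fixes f :: "('a::comm_ring_1, 'n::finite) laurent"
  shows "Poly_Mapping.lookup (lderiv i f) b
    = of_int (b $ i + 1) * Poly_Mapping.lookup f (b + axis i 1)"
proof -
  have "Poly_Mapping.lookup (lderiv i f) b = (\<Sum>a\<in>Poly_Mapping.keys f.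
      if a = b + axis i 1 then of_int (a $ i) * Poly_Mapping.lookup f a else 0)"
    unfolding lderiv_def lookup_sum
    by (intro sum.cong) (auto simp: lookup_single when_def algebra_simps)
  also have "\<dots> = of_int (b $ i + 1) * Poly_Mapping.lookup f (b + axis i 1)"
    by (simp add: sum.delta in_keys_iff)
  finally show ?thesis .
qed

text \<open>Differentiation and multiplication by the inverse variable both lower the
  \<open>i\<close>-th exponent by one, so their factors add up and the operator acts as a weighted
  shift of coefficients.\<close>

lemma lookup_Phi:
  "Poly_Mapping.lookup (Phi \<iota> lam i f) b
    = (of_int (b $ i + 1) + \<iota> (complex_of_real (lam $ i))) * Poly_Mapping.lookup f (b + axis i 1)"
proof -
  have "axis i (- 1) = - axis i (1::int)"
    by (simp add: vec_eq_iff axis_def)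
  then show ?thesis
    by (simp add: Phi_def lscale_def lconst_def lvar_inverse_def lookup_add lookup_lderiv
        lookup_single_times distrib_right)
qed

lemma Phi_zero [simp]: "Phi \<iota> lam i 0 = 0"
  by (intro poly_mapping_eqI) (simp add: lookup_Phi)

lemma polynomialsD:
  "\<lbrakk>f \<in> polynomials; Poly_Mapping.lookup f a \<noteq> 0\<rbrakk> \<Longrightarrow> 0 \<le> a $ i"
  by (auto simp: polynomials_def in_keys_iff)

lemma zero_in_polynomials [simp]: "0 \<in> polynomials"
  by (simp add: polynomials_def)

lemma Phi_surj_polynomials:
  fixes \<iota> :: "complex \<Rightarrow> 'a::idom" and lam :: "real ^ 'n"
  assumes "complex_embedding \<iota>" and lam: "lam $ i > - 1" and f: "f \<in> polynomials"
  obtains g where "g \<in> polynomials" and "Phi \<iota> lam i g = f"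
proof -
  interpret complex_embedding \<iota> by fact
  \<comment> \<open>This solves the weighted shift for the coefficients of the preimage. The
    denominator vanishes only if \<open>a $ i\<close> is at most 0, and there the coefficient of
    \<open>f\<close> is already 0.\<close>
  define h where "h a = \<iota> (1 / (of_int (a $ i) + complex_of_real (lam $ i)))
    * Poly_Mapping.lookup f (a - axis i 1)" for a
  \<comment> \<open>Finite support is what makes \<open>Abs_poly_mapping h\<close> have
    \<open>h\<close> as its coefficient function.\<close>
  have "{a. h a \<noteq> 0} \<subseteq> (\<lambda>a. a + axis i 1) ` Poly_Mapping.keys f"
  proof
    fix a assume "a \<in> {a. h a \<noteq> 0}"
    then have "a - axis i 1 \<in> Poly_Mapping.keys f"
      by (auto simp: h_def in_keys_iff)
    then show "a \<in> (\<lambda>a. a + axis i 1) ` Poly_Mapping.keys f"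
      by (intro image_eqI[where x = "a - axis i 1"]) simp_all
  qed
  then have "finite {a. h a \<noteq> 0}"
    by (rule finite_subset) simp
  then have lookup_g: "Poly_Mapping.lookup (Abs_poly_mapping h) = h"
    by simp
  show ?thesis
  proof
    show "Abs_poly_mapping h \<in> polynomials"
      unfolding polynomials_def
    proof (intro CollectI ballI allI)
      fix a j assume "a \<in> Poly_Mapping.keys (Abs_poly_mapping h)"
      then have "Poly_Mapping.lookup f (a - axis i 1) \<noteq> 0"
        by (auto simp: in_keys_iff lookup_g h_def)
      then have "0 \<le> (a - axis i 1) $ j"
        by (rule polynomialsD[OF f])
      then show "0 \<le> a $ j"
        by (simp add: axis_def split: if_splits)
    qed
    show "Phi \<iota> lam i (Abs_poly_mapping h) = f"
    proof (rule poly_mapping_eqI)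
      fix b
      \<comment> \<open>The weight at \<open>b\<close>, which is also the denominator in
        \<open>h\<close> at \<open>b + axis i 1\<close>.\<close>
      define x where "x = of_int (b $ i + 1) + complex_of_real (lam $ i)"
      have "Poly_Mapping.lookup (Phi \<iota> lam i (Abs_poly_mapping h)) b
          = \<iota> x * (\<iota> (1 / x) * Poly_Mapping.lookup f b)"
        unfolding lookup_Phi lookup_g h_def x_def embed_add embed_of_int
        by simp
      also have "\<dots> = Poly_Mapping.lookup f b"
      proof (cases "Poly_Mapping.lookup f b = 0")
        case False
        then have "0 \<le> b $ i"
          by (rule polynomialsD[OF f])
        then have "of_int (b $ i + 1) + lam $ i \<noteq> 0"
          using lam by simp
        then have "complex_of_real (of_int (b $ i + 1) + lam $ i) \<noteq> 0"
          by (simp only: of_real_eq_0_iff not_False_eq_True)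
        then have "x \<noteq> 0"
          by (simp add: x_def)
        then have "\<iota> x * \<iota> (1 / x) = 1"
          by (simp add: embed_one flip: embed_mult)
        then show ?thesis
          by (simp flip: mult.assoc)
      qed simp
      finally show "Poly_Mapping.lookup (Phi \<iota> lam i (Abs_poly_mapping h)) b
          = Poly_Mapping.lookup f b" .
    qed
  qed
qed

lemma Im'_eq_polynomials:
  fixes \<iota> :: "complex \<Rightarrow> 'a::idom" and lam :: "real ^ 'n"
  assumes "complex_embedding \<iota>" and "lam $ i > - 1"
  shows "Im' \<iota> lam = polynomials"
proof
  show "polynomials \<subseteq> Im' \<iota> lam"
  proof
    fix f :: "('a, 'n) laurent" assume f: "f \<in> polynomials"
    with assms obtain g where g: "g \<in> polynomials" "Phi \<iota> lam i g = f"
      by (rule Phi_surj_polynomials)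
    \<comment> \<open>The preimage goes into slot \<open>i\<close> and 0 into all others, so the sum
      collapses to \<open>f\<close>.\<close>
    have "(\<Sum>j\<in>UNIV. Phi \<iota> lam j (if j = i then g else 0)) = (\<Sum>j\<in>UNIV. if j = i then f else 0)"
      by (intro sum.cong) (auto simp: g)
    then have "f = (\<Sum>j\<in>UNIV. Phi \<iota> lam j (if j = i then g else 0))"
      by simp
    then show "f \<in> Im' \<iota> lam"
      unfolding Im'_def using f g(1)
      by (intro IntI CollectI exI[of _ "\<lambda>j. if j = i then g else 0"]) auto
  qed
qed (simp add: Im'_def)

lemma polynomials_add:
  "\<lbrakk>f \<in> polynomials; g \<in> polynomials\<rbrakk> \<Longrightarrow> f + g \<in> polynomials"
  using Poly_Mapping.keys_add[of f g] by (fastforce simp: polynomials_def)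

lemma polynomials_mult:
  "\<lbrakk>f \<in> polynomials; g \<in> polynomials\<rbrakk> \<Longrightarrow> f * g \<in> polynomials"
  using keys_mult[of f g] by (fastforce simp: polynomials_def)

lemma lconst_in_polynomials: "lconst c \<in> polynomials"
  by (simp add: polynomials_def lconst_def)

lemma lconst_one: "lconst 1 = 1"
  by (simp add: lconst_def)

lemma lconst_add: "lconst (a + b) = lconst a + lconst b"
  by (simp add: lconst_def single_add)

lemma lconst_mult: "lconst (a * b) = lconst a * lconst b"
  by (simp add: lconst_def mult_single)

text \<open>A subalgebra is closed under powers and products, so every \<open>a ^ m * b\<close>
  stays in it from the first exponent on.\<close>

lemma mathieu_subspace_self:
  assumes "commutative_algebra act" and "commutative_algebra.subalgebra act C"
  shows "mathieu_subspace act C C"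
proof -
  interpret commutative_algebra act by fact
  have C: "subspace C" "1 \<in> C" "\<And>x y. \<lbrakk>x \<in> C; y \<in> C\<rbrakk> \<Longrightarrow> x * y \<in> C"
    using assms(2) by (auto simp: subalgebra_def)
  have "a ^ m \<in> C" if "a \<in> C" for a and m :: nat
    by (induction m) (simp_all add: C that)
  then show ?thesis
    using assms C by (auto simp: mathieu_subspace_def)
qed

text \<open>A general ring homomorphism \<phi> covers both choices of scalars: the identity gives
  the algebra over the coefficient domain, and \<iota> the algebra over the complex numbers.\<close>

lemma mathieu_subspace_polynomials:
  fixes \<phi> :: "'r::comm_ring_1 \<Rightarrow> 'a::comm_ring_1"
  assumes "\<phi> 1 = 1" and "\<And>x y. \<phi> (x + y) = \<phi> x + \<phi> y" and "\<And>x y. \<phi> (x * y) = \<phi> x * \<phi> y"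
  shows "mathieu_subspace (\<lambda>c. lscale (\<phi> c)) polynomials
    (polynomials :: ('a, 'n::finite) laurent set)"
proof (rule mathieu_subspace_self)
  show alg: "commutative_algebra (\<lambda>c. lscale (\<phi> c) :: ('a, 'n) laurent \<Rightarrow> _)"
    by unfold_locales
      (simp_all add: lscale_def assms lconst_one lconst_add lconst_mult algebra_simps)
  interpret commutative_algebra "\<lambda>c. lscale (\<phi> c) :: ('a, 'n) laurent \<Rightarrow> _"
    by (fact alg)
  show "subalgebra (polynomials :: ('a, 'n) laurent set)"
    unfolding subalgebra_def subspace_def lscale_def
    using lconst_in_polynomials[of 1]
    by (auto simp: polynomials_add polynomials_mult lconst_in_polynomials lconst_one)
qed

theorem corollary2p10:
  fixes \<iota> :: "complex \<Rightarrow> 'a::idom" and lam :: "real ^ 'n"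
  assumes "complex_embedding \<iota>"
    and "\<And>i. lam $ i > - 1"
  shows "Im' \<iota> lam = polynomials
    \<and> mathieu_subspace lscale polynomials (Im' \<iota> lam)
    \<and> mathieu_subspace (\<lambda>c. lscale (\<iota> c)) polynomials (Im' \<iota> lam)"
proof -
  interpret complex_embedding \<iota> by fact
  have "Im' \<iota> lam = polynomials"
    using assms by (rule Im'_eq_polynomials)
  moreover have "mathieu_subspace lscale polynomials (polynomials :: ('a, 'n) laurent set)"
    using mathieu_subspace_polynomials[of "\<lambda>c. c"] by simp
  moreover have "mathieu_subspace (\<lambda>c. lscale (\<iota> c)) polynomials
      (polynomials :: ('a, 'n) laurent set)"
    by (intro mathieu_subspace_polynomials embed_one embed_add embed_mult)
  ultimately show ?thesis
    by simp
qed

end
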